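(* Let $X$ be a real 2-uniformly convex and uniformly smooth Banach space, and let $\mu\ge 1$ be a constant such that $\frac1\mu\|x-y\|^2\le\phi(x,y)$ for all $x,y\in X$. Let $\alpha>0$. Let $A:X\to 2^{X^*}$ be maximally monotone and $\alpha$-monotone, and let $B:X\to X^*$ be monotone and Lipschitz with constant $L>0$. Let $\epsilon$ satisfy $0<\epsilon<\alpha$ and let $(\lambda_n)_{n\ge -1}\subseteq\left[\epsilon,\frac{1-2\epsilon}{2\mu L}\right]$. For $x_0,x_{-1}\in X$ define $$x_{n+1}=J^A_{\lambda_n}\circ J^{-1}\bigl(Jx_n-\lambda_nBx_n-\lambda_{n-1}(Bx_n-Bx_{n-1})\bigr),\qquad n\ge 0.$$ Suppose $(A+B)^{-1}(0)\neq\emptyset$. Then $(x_n)$ converges strongly to an element $x^*$ of $(A+B)^{-1}(0)$, and there are constants $\theta>1$ and $M$ such that $\|x_{n+1}-x^*\|^2\le\frac{M}{\theta^n}$ for all $n\geq 0$.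
   Context: $J:X\to X^*$ is the normalized duality mapping: $Jx$ is the functional with $\langle x,Jx\rangle=\|x\|^2=\|Jx\|^2$ (single-valued and bijective here). $\phi(x,y)=\|x\|^2-2\langle x,Jy\rangle+\|y\|^2$. $X$ is 2-uniformly convex if its modulus of convexity satisfies $\delta_X(\varepsilon)\ge C\varepsilon^2$ for some $C>0$ and all $\varepsilon>0$ (on such a smooth space a constant $\mu$ as in the claim exists). For $\alpha\in\mathbb{R}$, an operator $A:X\rightrightarrows X^*$ is $\alpha$-monotone if $\langle x-y,u-v\rangle\ge\alpha\langle x-y,Jx-Jy\rangle$ for all $(x,u),(y,v)\in\mathrm{gra}\,A$; monotone means $0$-monotone, and maximally monotone means monotone with no proper monotone extension of the graph. $J^A_\lambda:=(J+\lambda A)^{-1}J$, so $J^A_\lambda\circ J^{-1}=(J+\lambda A)^{-1}$. $(A+B)^{-1}(0)=\{x: 0\in Ax+Bx\}$. *)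

theory Defs
  imports "HOL-Analysis.Analysis"
begin

(* The dual of a real normed space 'a is the type 'a \<Rightarrow>\<^sub>L real with the operator norm, and
   the pairing <x, u> is blinfun_apply u x.  Set-valued operators X => X* are functions into sets. *)

(* Values in ennreal: the infimum over the empty set (e > 2, or 'a trivial) is then infinity, and
   the supremum over the empty set ('a trivial) is 0.  The arguments of ennreal below are never
   negative on the index sets, so nothing is truncated. *)

definition modulus_of_convexity :: "'a::real_normed_vector itself \<Rightarrow> real \<Rightarrow> ennreal" where
  "modulus_of_convexity _ e =
     (INF (x, y) \<in> {(x::'a, y). norm x = 1 \<and> norm y = 1 \<and> e \<le> norm (x - y)}.
        ennreal (1 - norm (x + y) / 2))"

definition two_uniformly_convex :: "'a::real_normed_vector itself \<Rightarrow> bool" where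
  "two_uniformly_convex X \<longleftrightarrow>
     (\<exists>C>0. \<forall>e>0. modulus_of_convexity X e \<ge> ennreal (C * e\<^sup>2))"

definition modulus_of_smoothness :: "'a::real_normed_vector itself \<Rightarrow> real \<Rightarrow> ennreal" where
  "modulus_of_smoothness _ t =
     (SUP (x, y) \<in> {(x::'a, y). norm x = 1 \<and> norm y = 1}.
        ennreal ((norm (x + t *\<^sub>R y) + norm (x - t *\<^sub>R y)) / 2 - 1))"

definition uniformly_smooth :: "'a::real_normed_vector itself \<Rightarrow> bool" where
  "uniformly_smooth X \<longleftrightarrow>
     ((\<lambda>t. modulus_of_smoothness X t / ennreal t) \<longlongrightarrow> 0) (at_right 0)"

(* Existence and uniqueness of the functional hold on uniformly smooth spaces. *)
definition duality_map :: "'a::real_normed_vector \<Rightarrow> 'a \<Rightarrow>\<^sub>L real" where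
  "duality_map x =
     (THE u. blinfun_apply u x = (norm x)\<^sup>2 \<and> (norm x)\<^sup>2 = (norm u)\<^sup>2)"

definition phi :: "'a::real_normed_vector \<Rightarrow> 'a \<Rightarrow> real" where
  "phi x y = (norm x)\<^sup>2 - 2 * blinfun_apply (duality_map y) x + (norm y)\<^sup>2"

definition gra :: "('a \<Rightarrow> 'b set) \<Rightarrow> ('a \<times> 'b) set" where
  "gra A = {(x, u). u \<in> A x}"

definition single :: "('a \<Rightarrow> 'b) \<Rightarrow> 'a \<Rightarrow> 'b set" where
  "single f x = {f x}"

definition op_plus :: "('a \<Rightarrow> 'b::plus set) \<Rightarrow> ('a \<Rightarrow> 'b set) \<Rightarrow> 'a \<Rightarrow> 'b set" where
  "op_plus A B x = {u + v | u v. u \<in> A x \<and> v \<in> B x}"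

definition op_scale :: "real \<Rightarrow> ('a \<Rightarrow> 'b::real_vector set) \<Rightarrow> 'a \<Rightarrow> 'b set" where
  "op_scale l A x = (\<lambda>u. l *\<^sub>R u) ` A x"

definition op_inverse :: "('a \<Rightarrow> 'b set) \<Rightarrow> 'b \<Rightarrow> 'a set" where
  "op_inverse A u = {x. u \<in> A x}"

definition alpha_monotone ::
  "real \<Rightarrow> ('a::real_normed_vector \<Rightarrow> ('a \<Rightarrow>\<^sub>L real) set) \<Rightarrow> bool" where
  "alpha_monotone \<alpha> A \<longleftrightarrow>
     (\<forall>(x, u) \<in> gra A. \<forall>(y, v) \<in> gra A.
        blinfun_apply (u - v) (x - y)
          \<ge> \<alpha> * blinfun_apply (duality_map x - duality_map y) (x - y))"

definition monotone_op :: "('a::real_normed_vector \<Rightarrow> ('a \<Rightarrow>\<^sub>L real) set) \<Rightarrow> bool" where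
  "monotone_op A \<longleftrightarrow> alpha_monotone 0 A"

definition maximally_monotone :: "('a::real_normed_vector \<Rightarrow> ('a \<Rightarrow>\<^sub>L real) set) \<Rightarrow> bool" where
  "maximally_monotone A \<longleftrightarrow>
     monotone_op A \<and> \<not> (\<exists>A'. monotone_op A' \<and> gra A \<subset> gra A')"

(* Kept set-valued, (J + l A)^{-1} o J.  For l > 0 and maximally monotone A on the spaces
   considered it is everywhere defined and single-valued, and y \<in> resolvent A l x says
   that y is its value at x. *)
definition resolvent ::
  "('a::real_normed_vector \<Rightarrow> ('a \<Rightarrow>\<^sub>L real) set) \<Rightarrow> real \<Rightarrow> 'a \<Rightarrow> 'a set" where
  "resolvent A l x =
     op_inverse (op_plus (single duality_map) (op_scale l A)) (duality_map x)"

end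

theory Submission
  imports Defs
begin

text \<open>
  Let \<open>p\<close> be a zero of \<open>A + B\<close> and \<open>\<beta> = 1/2 - \<epsilon>\<close>. The three-point identity for \<open>\<phi>\<close>, \<open>\<alpha>\<close>-monotonicity
  of \<open>A\<close> and monotonicity of \<open>B\<close> show that
  \<open>E\<^sub>n = \<phi>(p, x\<^sub>n) - 2 \<lambda>\<^sub>n\<^sub>-\<^sub>1 \<langle>x\<^sub>n - p, Bx\<^sub>n - Bx\<^sub>n\<^sub>-\<^sub>1\<rangle> + \<beta>/\<mu> \<parallel>x\<^sub>n - x\<^sub>n\<^sub>-\<^sub>1\<parallel>\<^sup>2\<close>
  decreases by at least \<open>\<epsilon>\<alpha> \<phi>(p, x\<^sub>n\<^sub>+\<^sub>1) + 2\<epsilon>/\<mu> \<parallel>x\<^sub>n\<^sub>+\<^sub>1 - x\<^sub>n\<parallel>\<^sup>2\<close> in each step, which dominates a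
  fixed multiple of \<open>E\<^sub>n\<^sub>+\<^sub>1\<close>; moreover \<open>E\<^sub>n\<close> dominates \<open>\<phi>(p, x\<^sub>n) / 2\<close>, hence \<open>\<parallel>x\<^sub>n - p\<parallel>\<^sup>2 / (2\<mu>)\<close>.
  The iteration is meaningful because the duality map is single-valued (the norm is differentiable,
  its derivative being linear by uniform smoothness) and surjective (norming sequences of a
  functional are Cauchy by uniform convexity).
\<close>

section \<open>Pointwise forms of the two moduli\<close>

lemma two_uniformly_convexE:
  assumes "two_uniformly_convex TYPE('a::real_normed_vector)"
  obtains C where "C > 0"
    and "\<And>x y :: 'a. norm x = 1 \<Longrightarrow> norm y = 1 \<Longrightarrow> C * (norm (x - y))\<^sup>2 \<le> 1 - norm (x + y) / 2"
proof -
  obtain C where "C > 0"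
    and C: "\<And>e. e > 0 \<Longrightarrow> ennreal (C * e\<^sup>2) \<le> modulus_of_convexity TYPE('a) e"
    using assms unfolding two_uniformly_convex_def by auto
  have "C * (norm (x - y))\<^sup>2 \<le> 1 - norm (x + y) / 2"
    if "norm x = 1" "norm y = 1" for x y :: 'a
  \<comment> \<open>The modulus is bounded only for \<open>e > 0\<close>, so distance 0 is treated
    separately.\<close>
  proof (cases "x = y")
    case True
    with that show ?thesis
      using norm_triangle_ineq[of x y] by simp
  next
    case False
    then have "ennreal (C * (norm (x - y))\<^sup>2) \<le> modulus_of_convexity TYPE('a) (norm (x - y))"
      by (intro C) simp
    also have "\<dots> \<le> ennreal (1 - norm (x + y) / 2)"
      unfolding modulus_of_convexity_def
      by (rule INF_lower2[of "(x, y)"]) (use that in auto)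
    finally show ?thesis
      using norm_triangle_ineq[of x y] that by (subst (asm) ennreal_le_iff) auto
  qed
  with \<open>C > 0\<close> show ?thesis
    by (rule that)
qed

text \<open>One step \<open>t\<close> per \<open>e\<close> is enough for what follows: uniqueness of
  norming functionals tests a single \<open>t\<close>, and the directional derivative of the norm is
  an infimum over all \<open>t\<close>.\<close>

lemma uniformly_smoothE:
  assumes "uniformly_smooth TYPE('a::real_normed_vector)" and "e > 0"
  obtains t where "t > 0"
    and "\<And>x y :: 'a. norm x = 1 \<Longrightarrow> norm y = 1 \<Longrightarrow>
           norm (x + t *\<^sub>R y) + norm (x - t *\<^sub>R y) \<le> 2 + e * t"
proof -
  have "\<forall>\<^sub>F t in at_right 0. modulus_of_smoothness TYPE('a) t / ennreal t < ennreal (e / 2)"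
    using assms unfolding uniformly_smooth_def by (intro order_tendstoD) auto
  moreover have "\<forall>\<^sub>F t in at_right (0::real). t > 0"
    by (rule eventually_at_right_less)
  ultimately have "\<forall>\<^sub>F t in at_right (0::real).
      modulus_of_smoothness TYPE('a) t / ennreal t < ennreal (e / 2) \<and> t > 0"
    by (rule eventually_conj)
  then obtain t where t: "modulus_of_smoothness TYPE('a) t / ennreal t < ennreal (e / 2)" "t > 0"
    using eventually_happens[of _ "at_right (0::real)"] by force
  have "norm (x + t *\<^sub>R y) + norm (x - t *\<^sub>R y) \<le> 2 + e * t"
    if "norm x = 1" "norm y = 1" for x y :: 'a
  proof -
    have "ennreal ((norm (x + t *\<^sub>R y) + norm (x - t *\<^sub>R y)) / 2 - 1)
        \<le> modulus_of_smoothness TYPE('a) t"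
      unfolding modulus_of_smoothness_def
      by (rule SUP_upper2[of "(x, y)"]) (use that in auto)
    also have "\<dots> = modulus_of_smoothness TYPE('a) t / ennreal t * ennreal t"
      using \<open>t > 0\<close> by (simp add: ennreal_divide_times ennreal_mult_divide_eq)
    also have "\<dots> \<le> ennreal (e / 2) * ennreal t"
      using t by (intro mult_right_mono) auto
    also have "\<dots> = ennreal (e / 2 * t)"
      using t assms(2) by (subst ennreal_mult) auto
    finally show ?thesis
      using t(2) assms(2) by (subst (asm) ennreal_le_iff) (auto simp: field_simps)
  qed
  with \<open>t > 0\<close> show ?thesis
    by (rule that)
qed

section \<open>Norming functionals and the duality map\<close>

lemma blinfun_apply_le_norm:
  fixes u :: "'a::real_normed_vector \<Rightarrow>\<^sub>L real"
  shows "blinfun_apply u x \<le> norm u * norm x"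
  using norm_blinfun[of u x] by simp

text \<open>Testing \<open>u\<close> at \<open>x + t y\<close> and \<open>v\<close> at
  \<open>x - t y\<close> gives \<open>2 + t (u - v) y\<close> in total, while smoothness bounds the
  two norms by \<open>2 + e t\<close>. Hence \<open>(u - v) y \<le> e\<close> for every
  \<open>e\<close>, and replacing \<open>y\<close> by \<open>- y\<close> gives equality.\<close>

lemma norming_functional_unique:
  fixes x :: "'a::real_normed_vector" and u v :: "'a \<Rightarrow>\<^sub>L real"
  assumes smooth: "uniformly_smooth TYPE('a)" and "norm x = 1"
    and u: "blinfun_apply u x = 1" "norm u = 1" and v: "blinfun_apply v x = 1" "norm v = 1"
  shows "u = v"
proof -
  have unit: "blinfun_apply (u - v) y \<le> 0" if "norm y = 1" for y
  proof (rule field_le_epsilon)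
    fix e :: real assume "e > 0"
    then obtain t where "t > 0" and
      t: "\<And>x y :: 'a. norm x = 1 \<Longrightarrow> norm y = 1 \<Longrightarrow>
        norm (x + t *\<^sub>R y) + norm (x - t *\<^sub>R y) \<le> 2 + e * t"
      using uniformly_smoothE[OF smooth] by blast
    have "blinfun_apply u (x + t *\<^sub>R y) + blinfun_apply v (x - t *\<^sub>R y) \<le> 2 + e * t"
      using blinfun_apply_le_norm[of u "x + t *\<^sub>R y"]
        blinfun_apply_le_norm[of v "x - t *\<^sub>R y"]
        t[OF assms(2) that] u v by simp
    then have "t * blinfun_apply (u - v) y \<le> t * e"
      using u v by (simp add: blinfun.bilinear_simps algebra_simps)
    then show "blinfun_apply (u - v) y \<le> 0 + e"
      using \<open>t > 0\<close> by simp
  qed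
  have nonpos: "blinfun_apply (u - v) y \<le> 0" for y
  proof (cases "y = 0")
    case False
    then show ?thesis
      using unit[of "y /\<^sub>R norm y"]
      by (simp add: blinfun.scaleR_right mult_le_0_iff)
  qed (simp add: blinfun.zero_right)
  have "blinfun_apply (u - v) y = 0" for y
    using nonpos[of y] nonpos[of "- y"] by (simp add: blinfun.minus_right)
  then have "u - v = 0"
    by (intro blinfun_eqI) simp
  then show ?thesis
    by simp
qed

text \<open>The functional is the one-sided directional derivative of the norm at \<open>x\<close>.
  Convexity makes it sublinear, and smoothness makes it odd, hence linear.\<close>

lemma norming_functional_exists:
  fixes x :: "'a::real_normed_vector"
  assumes smooth: "uniformly_smooth TYPE('a)" and x: "norm x = 1"
  obtains u :: "'a \<Rightarrow>\<^sub>L real" where "blinfun_apply u x = 1" "norm u = 1"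
proof -
  \<comment> \<open>\<open>q h t\<close> is the difference quotient of the norm. It is nondecreasing
    in \<open>t\<close>, so its infimum \<open>p h\<close> is the limit at 0 from the right.\<close>
  define q where "q h t = (norm (x + t *\<^sub>R h) - 1) / t" for h t
  define p where "p h = (INF t\<in>{0<..}. q h t)" for h
  have q_lower: "- norm h \<le> q h t" and q_upper: "q h t \<le> norm h" if "t > 0" for h t
    using norm_triangle_ineq4[of "x + t *\<^sub>R h" "t *\<^sub>R h"] norm_triangle_ineq[of x "t *\<^sub>R h"] that x
    by (simp_all add: q_def field_simps)
  have q_mono: "q h s \<le> q h t" if "0 < s" "s \<le> t" for h s t
  proof -
    have "x + s *\<^sub>R h = (1 - s / t) *\<^sub>R x + (s / t) *\<^sub>R (x + t *\<^sub>R h)"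
      using that by (simp add: algebra_simps)
    then have le: "norm (x + s *\<^sub>R h) \<le> (1 - s / t) + (s / t) * norm (x + t *\<^sub>R h)"
      using norm_triangle_ineq[of "(1 - s / t) *\<^sub>R x" "(s / t) *\<^sub>R (x + t *\<^sub>R h)"] that x by simp
    have "norm (x + s *\<^sub>R h) - 1 \<le> s * q h t"
      using le by (simp add: q_def diff_divide_distrib right_diff_distrib)
    then show ?thesis
      using that by (simp add: q_def pos_divide_le_eq mult.commute)
  qed
  have p_le: "p h \<le> q h t" if "t > 0" for h t
    unfolding p_def using that q_lower[of _ h]
    by (intro cINF_lower) (auto intro!: bdd_belowI2[where m = "- norm h"])
  have le_p: "c \<le> p h" if "\<And>t. t > 0 \<Longrightarrow> c \<le> q h t" for c h
    unfolding p_def using that by (intro cINF_greatest) auto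
  have p_approx: "\<exists>t>0. q h t < p h + e" if "e > 0" for h e
    using le_p[of "p h + e" h] that by force
  have p_ge: "- norm h \<le> p h" for h
    by (intro le_p q_lower)
  have p_norm: "p h \<le> norm h" for h
    using p_le[of 1 h] q_upper[of 1 h] by simp
  have p_add_le: "p (h + k) \<le> p h + p k" for h k
  proof (rule field_le_epsilon)
    fix e :: real assume "e > 0"
    then obtain s t where s: "s > 0" "q h s < p h + e / 2" and t: "t > 0" "q k t < p k + e / 2"
      using p_approx[of "e / 2"] by (meson half_gt_zero)
    \<comment> \<open>Monotonicity of the quotients allows a common step for both directions. The
      half step for \<open>h + k\<close> then lands on the midpoint of \<open>x + r h\<close> and
      \<open>x + r k\<close>.\<close>
    define r where "r = min s t"
    have "r > 0" and r: "q h r < p h + e / 2" "q k r < p k + e / 2"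
      using s t q_mono[of r s h] q_mono[of r t k] by (auto simp: r_def)
    have "x + (r / 2) *\<^sub>R (h + k) = (1/2) *\<^sub>R (x + r *\<^sub>R h) + (1/2) *\<^sub>R (x + r *\<^sub>R k)"
      by (simp add: algebra_simps flip: scaleR_left_distrib)
    then have "norm (x + (r / 2) *\<^sub>R (h + k)) \<le> (norm (x + r *\<^sub>R h) + norm (x + r *\<^sub>R k)) / 2"
      using norm_triangle_ineq[of "(1/2) *\<^sub>R (x + r *\<^sub>R h)" "(1/2) *\<^sub>R (x + r *\<^sub>R k)"] by simp
    then have "2 * (norm (x + (r / 2) *\<^sub>R (h + k)) - 1) / r
        \<le> ((norm (x + r *\<^sub>R h) - 1) + (norm (x + r *\<^sub>R k) - 1)) / r"
      using \<open>r > 0\<close> by (intro divide_right_mono) simp_all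
    then have "q (h + k) (r / 2) \<le> q h r + q k r"
      by (simp add: q_def mult.commute flip: add_divide_distrib)
    then show "p (h + k) \<le> p h + p k + e"
      using p_le[of "r / 2" "h + k"] \<open>r > 0\<close> r by simp
  qed
  have p_zero: "p 0 = 0"
    using p_ge[of 0] p_norm[of 0] by simp
  have p_scale_le: "p (c *\<^sub>R h) \<le> c * p h" if "c > 0" for c h
  proof -
    have "p (c *\<^sub>R h) / c \<le> p h"
    proof (rule le_p)
      fix t :: real assume "t > 0"
      then show "p (c *\<^sub>R h) / c \<le> q h t"
        using p_le[of "t / c" "c *\<^sub>R h"] that by (simp add: q_def field_simps)
    qed
    then show ?thesis
      using that by (simp add: field_simps)
  qed
  \<comment> \<open>The converse inequality is \<open>p_scale_le\<close> for the factor
    \<open>1 / c\<close> at the vector \<open>c h\<close>.\<close>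
  have p_scale_pos: "p (c *\<^sub>R h) = c * p h" if "c > 0" for c h
    using p_scale_le[OF that, of h] p_scale_le[of "1 / c" "c *\<^sub>R h"] that
    by (simp add: field_simps)
  \<comment> \<open>Smoothness enters here: the quotients for \<open>h\<close> and
    \<open>- h\<close> add up to the symmetric second difference divided by
    \<open>t\<close>.\<close>
  have p_minus_unit: "p h + p (- h) \<le> 0" if "norm h = 1" for h
  proof (rule field_le_epsilon)
    fix e :: real assume "e > 0"
    then obtain t where "t > 0" and
      t: "\<And>x y :: 'a. norm x = 1 \<Longrightarrow> norm y = 1 \<Longrightarrow>
        norm (x + t *\<^sub>R y) + norm (x - t *\<^sub>R y) \<le> 2 + e * t"
      using uniformly_smoothE[OF smooth] by blast
    have "q h t + q (- h) t = (norm (x + t *\<^sub>R h) + norm (x - t *\<^sub>R h) - 2) / t"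
      by (simp add: q_def flip: add_divide_distrib)
    also have "\<dots> \<le> e"
      using t[OF x that] \<open>t > 0\<close> by (simp add: pos_divide_le_eq)
    finally have "q h t + q (- h) t \<le> e" .
    then show "p h + p (- h) \<le> 0 + e"
      using p_le[of t h] p_le[of t "- h"] \<open>t > 0\<close> by simp
  qed
  have p_minus: "p (- h) = - p h" for h
  proof (cases "h = 0")
    case False
    then have "p (h /\<^sub>R norm h) + p ((- h) /\<^sub>R norm h) \<le> 0"
      using p_minus_unit[of "h /\<^sub>R norm h"] by simp
    then have "inverse (norm h) * (p h + p (- h)) \<le> 0"
      using False by (simp only: p_scale_pos positive_imp_inverse_positive zero_less_norm_iff
          distrib_left not_False_eq_True)
    then have "p h + p (- h) \<le> 0"
      using False by (simp add: mult_le_0_iff)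
    then show ?thesis
      using p_add_le[of h "- h"] p_zero by simp
  qed (simp add: p_zero)
  \<comment> \<open>Subadditivity at \<open>- h\<close>, \<open>- k\<close> becomes superadditivity
    at \<open>h\<close>, \<open>k\<close> by oddness.\<close>
  have p_add: "p (h + k) = p h + p k" for h k
    using p_add_le[of h k] p_add_le[of "- h" "- k"] p_minus[of "h + k"] p_minus[of h] p_minus[of k]
    by simp
  have p_scale: "p (c *\<^sub>R h) = c * p h" for c h
  proof (cases c "0::real" rule: linorder_cases)
    case less
    then show ?thesis
      using p_scale_pos[of "- c" h] p_minus[of "c *\<^sub>R h"] by simp
  qed (simp_all add: p_zero p_scale_pos)
  have p_abs: "\<bar>p h\<bar> \<le> norm h" for h
    using p_ge[of h] p_norm[of h] by linarith
  then have "bounded_linear p"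
    by (intro bounded_linear_intro[where K = 1]) (simp_all add: p_add p_scale)
  then have apply_u: "blinfun_apply (Blinfun p) h = p h" for h
    by (simp add: bounded_linear_Blinfun_apply)
  have "q x t = 1" if "t > 0" for t
  proof -
    have "x + t *\<^sub>R x = (1 + t) *\<^sub>R x"
      by (simp add: algebra_simps)
    then show ?thesis
      using that x by (simp add: q_def)
  qed
  then have "1 \<le> p x"
    by (intro le_p) simp
  then have px: "p x = 1"
    using p_norm[of x] x by simp
  have "norm (Blinfun p) \<le> 1"
    using p_abs by (intro norm_blinfun_bound) (simp_all add: apply_u)
  moreover have "1 \<le> norm (Blinfun p)"
    using blinfun_apply_le_norm[of "Blinfun p" x] px x by (simp add: apply_u)
  ultimately show ?thesis
    using that[of "Blinfun p"] px by (simp add: apply_u)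
qed

text \<open>Dividing both \<open>x\<close> and \<open>u\<close> by \<open>norm x\<close> turns the
  two conditions into those of a norming functional of a unit vector.\<close>

lemma duality_map_ex1:
  fixes x :: "'a::real_normed_vector"
  assumes "uniformly_smooth TYPE('a)"
  shows "\<exists>!u. blinfun_apply u x = (norm x)\<^sup>2 \<and> (norm x)\<^sup>2 = (norm u)\<^sup>2"
proof (cases "x = 0")
  case True
  then show ?thesis
    by (auto simp: blinfun.zero_right)
next
  case False
  define e where "e = x /\<^sub>R norm x"
  have e: "norm e = 1"
    using False by (simp add: e_def)
  have eq: "blinfun_apply u x = (norm x)\<^sup>2 \<and> (norm x)\<^sup>2 = (norm u)\<^sup>2 \<longleftrightarrow>
      blinfun_apply (u /\<^sub>R norm x) e = 1 \<and> norm (u /\<^sub>R norm x) = 1" for u :: "'a \<Rightarrow>\<^sub>L real"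
  proof -
    have "blinfun_apply (u /\<^sub>R norm x) e = blinfun_apply u x / (norm x)\<^sup>2"
      by (simp add: e_def blinfun.bilinear_simps divide_inverse power2_eq_square)
    moreover have "norm (u /\<^sub>R norm x) = norm u / norm x"
      by (simp add: divide_inverse mult.commute)
    moreover have "(norm x)\<^sup>2 = (norm u)\<^sup>2 \<longleftrightarrow> norm u = norm x"
      by (metis norm_ge_zero power2_eq_iff_nonneg)
    ultimately show ?thesis
      using False by (simp only: divide_eq_1_iff norm_eq_zero zero_eq_power2) auto
  qed
  obtain u :: "'a \<Rightarrow>\<^sub>L real" where u: "blinfun_apply u e = 1" "norm u = 1"
    using norming_functional_exists[OF assms e] .
  have "v = norm x *\<^sub>R u"
    if "blinfun_apply v x = (norm x)\<^sup>2 \<and> (norm x)\<^sup>2 = (norm v)\<^sup>2" for v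
  proof -
    have "v /\<^sub>R norm x = u"
      using norming_functional_unique[OF assms e] u that eq by blast
    then have "norm x *\<^sub>R (v /\<^sub>R norm x) = norm x *\<^sub>R u"
      by (rule arg_cong)
    then show ?thesis
      using False by simp
  qed
  moreover have "blinfun_apply (norm x *\<^sub>R u) x = (norm x)\<^sup>2
      \<and> (norm x)\<^sup>2 = (norm (norm x *\<^sub>R u))\<^sup>2"
    unfolding eq using False u by simp
  ultimately show ?thesis
    by (rule ex1I[rotated])
qed

lemma duality_map_self:
  assumes "uniformly_smooth TYPE('a::real_normed_vector)"
  shows "blinfun_apply (duality_map x) (x :: 'a) = (norm x)\<^sup>2"
  using theI'[OF duality_map_ex1[OF assms, of x]] unfolding duality_map_def by blast

text \<open>This makes \<open>inv duality_map\<close> a genuine right inverse in the iteration. A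
  preimage of \<open>f\<close> is \<open>norm f\<close> times a unit vector \<open>z\<close> at
  which \<open>g = f / norm f\<close> attains its norm; \<open>z\<close> is the limit of a norming
  sequence.\<close>

lemma surj_duality_map:
  assumes smooth: "uniformly_smooth TYPE('a::banach)"
    and convex: "two_uniformly_convex TYPE('a)"
  shows "surj (duality_map :: 'a \<Rightarrow> _)"
proof -
  have "\<exists>x :: 'a. duality_map x = f" for f
  proof -
    have "\<exists>x :: 'a. blinfun_apply f x = (norm x)\<^sup>2 \<and> (norm x)\<^sup>2 = (norm f)\<^sup>2"
    proof (cases "f = 0")
      case True
      then show ?thesis
        by (intro exI[of _ 0]) simp
    next
      case False
      define g where "g = f /\<^sub>R norm f"
      have g: "norm g = 1"
        using False by (simp add: g_def)
      obtain C where "C > 0" and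
        C: "\<And>x y :: 'a. norm x = 1 \<Longrightarrow> norm y = 1 \<Longrightarrow>
          C * (norm (x - y))\<^sup>2 \<le> 1 - norm (x + y) / 2"
        using two_uniformly_convexE[OF convex] by blast
      have near: "\<exists>y. norm y = 1 \<and> blinfun_apply g y > 1 - e" if "0 < e" "e \<le> 1" for e
      proof -
        have "\<not> (\<forall>y. norm (blinfun_apply g y) \<le> (1 - e) * norm y)"
          using norm_blinfun_bound[of "1 - e" g] g that by auto
        then obtain y where y: "norm (blinfun_apply g y) > (1 - e) * norm y"
          by (auto simp: not_le)
        then have "y \<noteq> 0"
          by auto
        \<comment> \<open>The sign factor turns the bound on the absolute value into a bound on the
          value itself.\<close>
        let ?z = "(sgn (blinfun_apply g y) / norm y) *\<^sub>R y"
        have "blinfun_apply g y \<noteq> 0"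
          using y that by (auto simp: mult_less_0_iff)
        then have "norm ?z = 1"
          using \<open>y \<noteq> 0\<close> by (simp add: abs_sgn_eq)
        moreover have "blinfun_apply g ?z = norm (blinfun_apply g y) / norm y"
          by (simp add: blinfun.scaleR_right abs_sgn mult.commute)
        ultimately show ?thesis
          using y \<open>y \<noteq> 0\<close> by (intro exI[of _ ?z]) (simp add: pos_less_divide_eq)
      qed
      have "\<forall>n. \<exists>y. norm y = 1 \<and> blinfun_apply g y > 1 - inverse (real (Suc n))"
        by (intro allI near) (simp_all add: inverse_le_1_iff)
      then obtain y where y: "\<And>n. norm (y n) = 1"
        and gy: "\<And>n. blinfun_apply g (y n) > 1 - inverse (real (Suc n))"
        by metis
      have "Cauchy y"
      proof (rule CauchyI)
        fix e :: real assume "e > 0"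
        then obtain N where N: "inverse (real (Suc N)) < C * e\<^sup>2"
          using reals_Archimedean[of "C * e\<^sup>2"] \<open>C > 0\<close> by auto
        have "norm (y m - y n) < e" if "m \<ge> N" "n \<ge> N" for m n
        proof -
          have "inverse (real (Suc m)) \<le> inverse (real (Suc N))"
            "inverse (real (Suc n)) \<le> inverse (real (Suc N))"
            using that by (auto intro!: le_imp_inverse_le)
          moreover have "blinfun_apply g (y m) + blinfun_apply g (y n) \<le> norm (y m + y n)"
            using blinfun_apply_le_norm[of g "y m + y n"] g by (simp add: blinfun.add_right)
          \<comment> \<open>Since \<open>g\<close> nearly attains 1 at both points,
            \<open>norm (y m + y n) / 2\<close> exceeds \<open>1 - inverse (Suc N)\<close>, and
            convexity forces the points together.\<close>
          ultimately have "C * (norm (y m - y n))\<^sup>2 < C * e\<^sup>2"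
            using C[OF y y, of m n] gy[of m] gy[of n] N by linarith
          then show ?thesis
            using \<open>C > 0\<close> \<open>e > 0\<close> by (simp add: power_less_imp_less_base)
        qed
        then show "\<exists>N. \<forall>m\<ge>N. \<forall>n\<ge>N. norm (y m - y n) < e"
          by blast
      qed
      then obtain z where z: "y \<longlonglongrightarrow> z"
        using Cauchy_convergent convergent_def by blast
      have "norm z = 1"
        using tendsto_norm[OF z] y by (simp add: LIMSEQ_const_iff)
      have "(\<lambda>n. blinfun_apply g (y n)) \<longlonglongrightarrow> blinfun_apply g z"
        by (intro tendsto_intros z)
      moreover have "(\<lambda>n. 1 - inverse (real (Suc n))) \<longlonglongrightarrow> 1 - 0"
        by (intro tendsto_intros LIMSEQ_inverse_real_of_nat)
      ultimately have "1 - 0 \<le> blinfun_apply g z"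
        using gy by (intro LIMSEQ_le[rotated]) (auto intro: less_imp_le)
      then have "blinfun_apply g z = 1"
        using blinfun_apply_le_norm[of g z] g \<open>norm z = 1\<close> by simp
      then have "blinfun_apply f (norm f *\<^sub>R z) = (norm f)\<^sup>2"
        using False by (simp add: g_def blinfun.bilinear_simps field_simps power2_eq_square)
      then show ?thesis
        using \<open>norm z = 1\<close> by (intro exI[of _ "norm f *\<^sub>R z"]) simp
    qed
    then obtain x :: 'a where "blinfun_apply f x = (norm x)\<^sup>2 \<and> (norm x)\<^sup>2 = (norm f)\<^sup>2"
      by blast
    then have "duality_map x = f"
      unfolding duality_map_def by (intro the1_equality duality_map_ex1 smooth)
    then show ?thesis
      by blast
  qed
  then show ?thesis
    by (metis surjI)
qed

section \<open>The Lyapunov function and its decrease\<close>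

text \<open>This is \<open>E_n\<close> with the sequence abstracted away: \<open>l\<close>,
  \<open>w\<close>, \<open>y\<close> stand for the previous step size, the previous iterate and the
  current iterate.\<close>

definition lyapunov ::
  "real \<Rightarrow> real \<Rightarrow> ('a::real_normed_vector \<Rightarrow> 'a \<Rightarrow>\<^sub>L real) \<Rightarrow> 'a \<Rightarrow> real \<Rightarrow> 'a \<Rightarrow> 'a \<Rightarrow> real" where
  "lyapunov \<mu> \<epsilon> B p l w y =
     phi p y - 2 * l * blinfun_apply (B y - B w) (y - p) + (1/2 - \<epsilon>) / \<mu> * (norm (y - w))\<^sup>2"

text \<open>The upper limit on the step size says exactly that
  \<open>l L \<le> (1/2 - \<epsilon>) / \<mu>\<close>; the Lipschitz bound and
  \<open>2ab \<le> a^2 + b^2\<close> do the rest.\<close>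

lemma cross_term_bound:
  fixes B :: "'a::real_normed_vector \<Rightarrow> 'a \<Rightarrow>\<^sub>L real"
  assumes "\<mu> > 0" "L > 0" "L-lipschitz_on UNIV B" "0 \<le> l" "l \<le> (1 - 2 * \<epsilon>) / (2 * \<mu> * L)"
  shows "\<bar>2 * l * blinfun_apply (B y - B w) h\<bar> \<le> (1/2 - \<epsilon>) / \<mu> * ((norm h)\<^sup>2 + (norm (y - w))\<^sup>2)"
proof -
  have l: "2 * l * L \<le> 2 * ((1/2 - \<epsilon>) / \<mu>)"
    using assms by (simp add: field_simps)
  have "\<bar>blinfun_apply (B y - B w) h\<bar> \<le> norm (B y - B w) * norm h"
    using norm_blinfun[of "B y - B w" h] by simp
  also have "\<dots> \<le> L * norm (y - w) * norm h"
    using lipschitz_onD[OF assms(3), of y w] by (intro mult_right_mono) (auto simp: dist_norm)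
  finally have "\<bar>2 * l * blinfun_apply (B y - B w) h\<bar> \<le> 2 * l * (L * norm (y - w) * norm h)"
    using \<open>0 \<le> l\<close> by (simp add: abs_mult mult_left_mono)
  also have "\<dots> = 2 * l * L * (norm (y - w) * norm h)"
    by simp
  also have "\<dots> \<le> 2 * ((1/2 - \<epsilon>) / \<mu>) * (norm (y - w) * norm h)"
    using l by (intro mult_right_mono) auto
  also have "\<dots> = (1/2 - \<epsilon>) / \<mu> * (2 * norm h * norm (y - w))"
    by simp
  also have "\<dots> \<le> (1/2 - \<epsilon>) / \<mu> * ((norm h)\<^sup>2 + (norm (y - w))\<^sup>2)"
  proof (rule mult_left_mono)
    show "2 * norm h * norm (y - w) \<le> (norm h)\<^sup>2 + (norm (y - w))\<^sup>2"
      by (rule sum_squares_bound)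
    have "0 \<le> 2 * l * L"
      using assms by simp
    with l show "0 \<le> (1/2 - \<epsilon>) / \<mu>"
      by linarith
  qed
  finally show ?thesis .
qed

text \<open>With \<open>h = y - p\<close>, the cross term costs at most \<open>phi p y / 2\<close>
  plus a multiple of \<open>(norm (y - w))^2\<close>. That multiple equals the last summand of
  \<open>lyapunov\<close>, so it cancels from below and doubles from above.\<close>

lemma lyapunov_bounds:
  fixes B :: "'a::real_normed_vector \<Rightarrow> 'a \<Rightarrow>\<^sub>L real"
  assumes "\<mu> > 0" "L > 0" "L-lipschitz_on UNIV B" "0 < \<epsilon>"
    and "0 < l" "l \<le> (1 - 2 * \<epsilon>) / (2 * \<mu> * L)"
    and phi: "1 / \<mu> * (norm (p - y))\<^sup>2 \<le> phi p y"
  shows "phi p y / 2 \<le> lyapunov \<mu> \<epsilon> B p l w y"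
    and "lyapunov \<mu> \<epsilon> B p l w y \<le> 3 / 2 * phi p y + (norm (y - w))\<^sup>2 / \<mu>"
proof -
  let ?\<beta> = "1/2 - \<epsilon>"
  \<comment> \<open>A positive admissible step size forces \<open>\<epsilon> < 1/2\<close>.\<close>
  have "0 < (1 - 2 * \<epsilon>) / (2 * \<mu> * L)"
    using assms by linarith
  then have \<beta>: "0 \<le> ?\<beta>" "?\<beta> \<le> 1/2"
    using assms by (auto simp: zero_less_divide_iff mult_less_0_iff)
  have "0 \<le> 1 / \<mu> * (norm (p - y))\<^sup>2"
    using \<open>\<mu> > 0\<close> by simp
  with phi have phi_nonneg: "0 \<le> phi p y"
    by linarith
  have "?\<beta> / \<mu> * (norm (y - p))\<^sup>2 \<le> ?\<beta> * phi p y"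
    using mult_left_mono[OF phi \<beta>(1)] by (simp add: norm_minus_commute)
  also have "\<dots> \<le> 1/2 * phi p y"
    using \<beta> phi_nonneg by (intro mult_right_mono)
  finally have A: "?\<beta> / \<mu> * (norm (y - p))\<^sup>2 \<le> phi p y / 2"
    by simp
  have C: "\<bar>2 * l * blinfun_apply (B y - B w) (y - p)\<bar>
      \<le> ?\<beta> / \<mu> * (norm (y - p))\<^sup>2 + ?\<beta> / \<mu> * (norm (y - w))\<^sup>2"
    using cross_term_bound[of \<mu> L B l \<epsilon> y w "y - p"] assms by (simp add: distrib_left)
  show "phi p y / 2 \<le> lyapunov \<mu> \<epsilon> B p l w y"
    using A C unfolding lyapunov_def by linarith
  have "?\<beta> / \<mu> * (norm (y - w))\<^sup>2 \<le> (1/2) / \<mu> * (norm (y - w))\<^sup>2"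
    using \<beta> \<open>\<mu> > 0\<close> by (intro mult_right_mono divide_right_mono) auto
  then have "2 * (?\<beta> / \<mu> * (norm (y - w))\<^sup>2) \<le> (norm (y - w))\<^sup>2 / \<mu>"
    by simp
  then show "lyapunov \<mu> \<epsilon> B p l w y \<le> 3 / 2 * phi p y + (norm (y - w))\<^sup>2 / \<mu>"
    using A C unfolding lyapunov_def by linarith
qed

text \<open>One iteration from \<open>w\<close>, \<open>y\<close> to \<open>z\<close>, with
  \<open>l'\<close> the old and \<open>l\<close> the new step size. \<alpha>-monotonicity of
  \<open>A\<close> is applied to \<open>a \<in> A z\<close> and \<open>- B p \<in> A p\<close>, and
  \<open>a\<close> is then eliminated through the step equation.\<close>

lemma lyapunov_decrease:
  fixes B :: "'a::real_normed_vector \<Rightarrow> 'a \<Rightarrow>\<^sub>L real"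
  assumes smooth: "uniformly_smooth TYPE('a)"
    and "\<mu> > 0" "L > 0" "L-lipschitz_on UNIV B" "0 < \<epsilon>"
    and phi: "\<And>y z :: 'a. 1 / \<mu> * (norm (y - z))\<^sup>2 \<le> phi y z"
    and \<alpha>: "\<alpha> > 0" "alpha_monotone \<alpha> A" and B: "monotone_op (single B)"
    and l': "0 < l'" "l' \<le> (1 - 2 * \<epsilon>) / (2 * \<mu> * L)" and l: "\<epsilon> \<le> l"
    and p: "- B p \<in> A p"
    and a: "a \<in> A z"
    and step: "duality_map z + l *\<^sub>R a
      = duality_map y - l *\<^sub>R B y - l' *\<^sub>R (B y - B w)"
  shows "lyapunov \<mu> \<epsilon> B p l y z + \<epsilon> * \<alpha> * phi p z + 2 * \<epsilon> / \<mu> * (norm (z - y))\<^sup>2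
    \<le> lyapunov \<mu> \<epsilon> B p l' w y"
proof -
  let ?J = "duality_map :: 'a \<Rightarrow> _"
  note [simp] = blinfun.bilinear_simps
  have J: "blinfun_apply (?J v) v = (norm v)\<^sup>2" for v
    by (rule duality_map_self[OF smooth])
  have phi_nonneg: "0 \<le> phi v v'" for v v' :: 'a
    using phi[of v v'] order_trans[of 0 "1 / \<mu> * (norm (v - v'))\<^sup>2"] \<open>\<mu> > 0\<close> by simp
  have sym: "2 * blinfun_apply (?J z - ?J p) (z - p) = phi p z + phi z p"
    by (simp add: phi_def J)
  have three_point: "phi p y - phi p z - phi z y = 2 * blinfun_apply (?J y - ?J z) (z - p)"
    by (simp add: phi_def J)
  have "\<alpha> * blinfun_apply (?J z - ?J p) (z - p) \<le> blinfun_apply (a + B p) (z - p)"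
    using \<alpha>(2) p a unfolding alpha_monotone_def gra_def by fastforce
  then have "l * (\<alpha> * blinfun_apply (?J z - ?J p) (z - p)) \<le> l * blinfun_apply (a + B p) (z - p)"
    using l \<open>0 < \<epsilon>\<close> by (intro mult_left_mono) auto
  then have mono_A: "l * \<alpha> * (phi p z + phi z p) \<le> 2 * blinfun_apply (l *\<^sub>R a + l *\<^sub>R B p) (z - p)"
    by (simp add: algebra_simps flip: sym)
  have "0 \<le> blinfun_apply (B z - B p) (z - p)"
    using B unfolding monotone_op_def alpha_monotone_def gra_def single_def by auto
  then have mono_B: "0 \<le> l * blinfun_apply (B z - B p) (z - p)"
    using l \<open>0 < \<epsilon>\<close> by simp
  have la: "l *\<^sub>R a = ?J y - ?J z - l *\<^sub>R B y - l' *\<^sub>R (B y - B w)"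
    using step by (simp add: algebra_simps)
  \<comment> \<open>Two rewritings shape this: \<open>B p - B y\<close> passes through
    \<open>B z\<close>, producing the cross term of the new Lyapunov value, and \<open>z - p\<close>
    passes through \<open>y\<close> in the correction term, producing the cross term of the old
    one.\<close>
  have split: "2 * blinfun_apply (l *\<^sub>R a + l *\<^sub>R B p) (z - p)
      = (phi p y - phi p z - phi z y) + 2 * l * blinfun_apply (B z - B y) (z - p)
        - 2 * (l * blinfun_apply (B z - B p) (z - p))
        - 2 * l' * blinfun_apply (B y - B w) (y - p) - 2 * l' * blinfun_apply (B y - B w) (z - y)"
    unfolding three_point la by (simp add: algebra_simps)
  have cross: "\<bar>2 * l' * blinfun_apply (B y - B w) (z - y)\<bar>
      \<le> (1/2 - \<epsilon>) / \<mu> * (norm (z - y))\<^sup>2 + (1/2 - \<epsilon>) / \<mu> * (norm (y - w))\<^sup>2"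
    using cross_term_bound[of \<mu> L B l' \<epsilon> y w "z - y"] assms by (simp add: distrib_left)
  have "\<epsilon> * \<alpha> * phi p z \<le> l * \<alpha> * phi p z"
    using l \<alpha> phi_nonneg by (intro mult_right_mono) auto
  moreover have "0 \<le> l * \<alpha> * phi z p"
    using l \<alpha> \<open>0 < \<epsilon>\<close> phi_nonneg by simp
  ultimately have gain: "\<epsilon> * \<alpha> * phi p z \<le> l * \<alpha> * (phi p z + phi z p)"
    by (simp add: distrib_left)
  \<comment> \<open>The lower bound on \<open>phi z y\<close> is spent in three shares: one pays for
    \<open>cross\<close>, an equal one is the last summand of the new Lyapunov value, and the
    \<epsilon>-share remains as gain.\<close>
  have "1 / \<mu> * (norm (z - y))\<^sup>2 = 2 * ((1/2 - \<epsilon>) / \<mu> * (norm (z - y))\<^sup>2)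
      + 2 * \<epsilon> / \<mu> * (norm (z - y))\<^sup>2"
    using \<open>\<mu> > 0\<close> by (simp add: field_simps)
  then show ?thesis
    using mono_A mono_B split cross gain phi[of z y] unfolding lyapunov_def by linarith
qed

section \<open>Linear convergence of the iteration\<close>

theorem corollary4p2:
  fixes A :: "'a::banach \<Rightarrow> ('a \<Rightarrow>\<^sub>L real) set"
    and B :: "'a \<Rightarrow> 'a \<Rightarrow>\<^sub>L real"
    and \<mu> \<alpha> L \<epsilon> :: real
    and lam :: "int \<Rightarrow> real"
    and x :: "int \<Rightarrow> 'a"
  assumes "two_uniformly_convex TYPE('a)"
    and "uniformly_smooth TYPE('a)"
    and "\<mu> \<ge> 1"
    and "\<And>y z :: 'a. 1 / \<mu> * (norm (y - z))\<^sup>2 \<le> phi y z"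
    and "\<alpha> > 0"
    and "maximally_monotone A"
    and "alpha_monotone \<alpha> A"
    and "monotone_op (single B)"
    and "L > 0"
    and "L-lipschitz_on UNIV B"
    and "0 < \<epsilon>" and "\<epsilon> < \<alpha>"
    and "\<And>n. n \<ge> -1 \<Longrightarrow> lam n \<in> {\<epsilon> .. (1 - 2 * \<epsilon>) / (2 * \<mu> * L)}"
    and "\<And>n. n \<ge> 0 \<Longrightarrow>
           x (n + 1) \<in> resolvent A (lam n)
             (inv duality_map
               (duality_map (x n) - lam n *\<^sub>R B (x n)
                 - lam (n - 1) *\<^sub>R (B (x n) - B (x (n - 1)))))"
    and "op_inverse (op_plus A (single B)) 0 \<noteq> {}"
  shows "\<exists>xs \<in> op_inverse (op_plus A (single B)) 0.
           (\<lambda>n::nat. x (int n)) \<longlonglongrightarrow> xs \<and>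
           (\<exists>\<theta>>1. \<exists>M. \<forall>n::nat. (norm (x (int n + 1) - xs))\<^sup>2 \<le> M / \<theta> ^ n)"
proof -
  note smooth = assms(2) and phi = assms(4) and lip = assms(10)
  have "\<mu> > 0"
    using assms(3) by simp
  have lam: "\<epsilon> \<le> lam n" "0 < lam n" "lam n \<le> (1 - 2 * \<epsilon>) / (2 * \<mu> * L)" if "n \<ge> -1" for n
    using assms(13)[OF that] \<open>0 < \<epsilon>\<close> by auto
  from assms(15) obtain p where p: "p \<in> op_inverse (op_plus A (single B)) 0"
    by blast
  then have Ap: "- B p \<in> A p"
    by (auto simp: op_inverse_def op_plus_def single_def add_eq_0_iff2)
  \<comment> \<open>\<open>E 0\<close> involves index -1, which is why the sequences are indexed by
    integers.\<close>
  define E where "E n = lyapunov \<mu> \<epsilon> B p (lam (int n - 1)) (x (int n - 1)) (x (int n))" for n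
  \<comment> \<open>Each argument of the minimum is the ratio of a gain per step to the matching
    coefficient in the upper bound of \<open>E\<close>: \<open>\<epsilon> \<alpha>\<close> against
    \<open>3 / 2\<close>, and \<open>2 \<epsilon>\<close> against 1.\<close>
  define \<kappa> where "\<kappa> = min (2 / 3 * \<epsilon> * \<alpha>) (2 * \<epsilon>)"
  have "\<kappa> > 0"
    using \<open>0 < \<epsilon>\<close> \<open>\<alpha> > 0\<close> by (simp add: \<kappa>_def)
  have norm_le_phi: "(norm (p - y))\<^sup>2 \<le> \<mu> * phi p y" for y
    using phi[of p y] \<open>\<mu> > 0\<close> by (simp add: field_simps)
  then have phi_nonneg: "0 \<le> phi p y" for y
    using \<open>\<mu> > 0\<close> zero_le_mult_iff[of \<mu> "phi p y"] order_trans[OF zero_le_power2 norm_le_phi]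
    by fastforce
  have E_lower: "phi p (x (int n)) / 2 \<le> E n" for n
    unfolding E_def using lam[of "int n - 1"]
    by (intro lyapunov_bounds(1)[OF \<open>\<mu> > 0\<close> assms(9) lip assms(11) _ _ phi]) auto
  have E_step: "(1 + \<kappa>) * E (Suc n) \<le> E n" for n
  proof -
    let ?y = "x (int n)" and ?z = "x (int n + 1)" and ?w = "x (int n - 1)"
    let ?D = "(norm (?z - ?y))\<^sup>2 / \<mu>"
    define v where
      "v = duality_map ?y - lam (int n) *\<^sub>R B ?y - lam (int n - 1) *\<^sub>R (B ?y - B ?w)"
    have "duality_map (inv duality_map v :: 'a) = v"
      using surj_duality_map[OF smooth assms(1)] by (rule surj_f_inv_f)
    then obtain a where "a \<in> A ?z" and a: "duality_map ?z + lam (int n) *\<^sub>R a = v"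
      using assms(14)[of "int n"]
      by (auto simp: v_def resolvent_def op_inverse_def op_plus_def single_def op_scale_def)
    have "lyapunov \<mu> \<epsilon> B p (lam (int n)) ?y ?z + \<epsilon> * \<alpha> * phi p ?z
        + 2 * \<epsilon> / \<mu> * (norm (?z - ?y))\<^sup>2 \<le> lyapunov \<mu> \<epsilon> B p (lam (int n - 1)) ?w ?y"
      using \<open>\<mu> > 0\<close> lam[of "int n - 1"] lam[of "int n"]
      by (intro lyapunov_decrease[OF smooth _ assms(9) lip assms(11) phi assms(5,7,8) _ _ _ Ap
            \<open>a \<in> A ?z\<close>] a[unfolded v_def]) auto
    then have decrease: "E (Suc n) + \<epsilon> * \<alpha> * phi p ?z + 2 * \<epsilon> * ?D \<le> E n"
      by (simp add: E_def add.commute)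
    have "E (Suc n) \<le> 3 / 2 * phi p ?z + ?D"
      using lyapunov_bounds(2)[where w = ?y, OF \<open>\<mu> > 0\<close> assms(9) lip assms(11) _ _ phi[of p ?z]]
        lam[of "int n"] by (simp add: E_def add.commute)
    then have "\<kappa> * E (Suc n) \<le> \<kappa> * (3 / 2 * phi p ?z + ?D)"
      using \<open>\<kappa> > 0\<close> by (intro mult_left_mono) auto
    also have "\<dots> = \<kappa> * (3 / 2 * phi p ?z) + \<kappa> * ?D"
      by (rule distrib_left)
    also have "\<dots> \<le> (2 / 3 * \<epsilon> * \<alpha>) * (3 / 2 * phi p ?z) + 2 * \<epsilon> * ?D"
      using phi_nonneg[of ?z] \<open>\<mu> > 0\<close> by (intro add_mono mult_right_mono) (auto simp: \<kappa>_def)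
    also have "\<dots> = \<epsilon> * \<alpha> * phi p ?z + 2 * \<epsilon> * ?D"
      by simp
    finally have "\<kappa> * E (Suc n) \<le> \<epsilon> * \<alpha> * phi p ?z + 2 * \<epsilon> * ?D" .
    with decrease show ?thesis
      unfolding distrib_right by linarith
  qed
  have E_bound: "E n \<le> E 0 / (1 + \<kappa>) ^ n" for n
  proof (induction n)
    case (Suc n)
    have "E (Suc n) \<le> E n / (1 + \<kappa>)"
      using E_step[of n] \<open>\<kappa> > 0\<close> by (simp add: field_simps)
    also have "\<dots> \<le> E 0 / (1 + \<kappa>) ^ n / (1 + \<kappa>)"
      using Suc \<open>\<kappa> > 0\<close> by (intro divide_right_mono) auto
    finally show ?case
      by (simp add: mult.commute)
  qed simp
  \<comment> \<open>The factor 2 comes from \<open>E_lower\<close>, and \<mu> from passing from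
    \<open>phi\<close> to the squared norm.\<close>
  define M where "M = 2 * \<mu> * E 0"
  have rate: "(norm (x (int n) - p))\<^sup>2 \<le> M / (1 + \<kappa>) ^ n" for n
  proof -
    have "(norm (x (int n) - p))\<^sup>2 \<le> \<mu> * phi p (x (int n))"
      using norm_le_phi[of "x (int n)"] by (simp add: norm_minus_commute)
    also have "\<dots> \<le> \<mu> * (2 * (E 0 / (1 + \<kappa>) ^ n))"
      using E_lower[of n] E_bound[of n] \<open>\<mu> > 0\<close> by (intro mult_left_mono) auto
    finally show ?thesis
      by (simp add: M_def mult_ac)
  qed
  \<comment> \<open>The sign is needed to discard the surplus factor \<open>1 + \<kappa>\<close>
    when the rate at \<open>n + 1\<close> is restated with exponent \<open>n\<close>.\<close>
  have "M \<ge> 0"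
    using rate[of 0] order_trans[OF zero_le_power2] by fastforce
  have "(\<lambda>n. M / (1 + \<kappa>) ^ n) \<longlonglongrightarrow> 0"
    using \<open>\<kappa> > 0\<close> by (intro LIMSEQ_divide_realpow_zero) simp
  then have "(\<lambda>n. (norm (x (int n) - p))\<^sup>2) \<longlonglongrightarrow> 0"
    by (rule tendsto_sandwich[OF _ _ tendsto_const, rotated 2]) (simp_all add: rate)
  then have "(\<lambda>n. norm (x (int n) - p)) \<longlonglongrightarrow> 0"
    using tendsto_real_sqrt by fastforce
  then have lim: "(\<lambda>n. x (int n)) \<longlonglongrightarrow> p"
    by (rule LIM_zero_cancel[OF tendsto_norm_zero_cancel])
  have "(norm (x (int n + 1) - p))\<^sup>2 \<le> M / (1 + \<kappa>) ^ n" for n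
  proof -
    have "(norm (x (int n + 1) - p))\<^sup>2 \<le> M / (1 + \<kappa>) ^ Suc n"
      using rate[of "Suc n"] by (simp add: add.commute)
    also have "\<dots> \<le> M / (1 + \<kappa>) ^ n"
      using \<open>M \<ge> 0\<close> \<open>\<kappa> > 0\<close> by (intro divide_left_mono power_increasing) auto
    finally show ?thesis .
  qed
  with p lim \<open>\<kappa> > 0\<close> show ?thesis
    by (intro bexI[of _ p] conjI exI[of _ "1 + \<kappa>"] exI[of _ M]) auto
qed

end
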